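(* No protocol for message exchange in the full termination model is resilient to a $0.358$ fraction of errors relative to the total number of rounds.
   Context: Message exchange: Alice holds $x\in\{0,1\}^n$, Bob holds $y\in\{0,1\}^n$, and the goal is that both parties output $(x,y)$. Full termination model: the protocol is deterministic and proceeds in rounds; in each round a single party, fixed beforehand, sends one symbol of an alphabet $\Sigma$ to the other party. At any round a party may irreversibly terminate, giving an output; it then neither speaks nor listens. From then on, as long as the other party has not terminated, in each round where the terminated party is the designated speaker a special symbol $\emptyset$ is automatically sent. The adversary may corrupt any round (including rounds in which $\emptyset$ is sent) into any symbol. The protocol is resilient to an $\alpha$ fraction of errors if for all inputs $x,y$ and all adversarial attacks in which the last party to terminate does so at round $R$, if the number of corrupted rounds is at most $\alpha R$, then both Alice and Bob output $(x,y)$.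
   Formalization: Proved for each fixed finite alphabet and all sufficiently large n (for n=1 sending one symbol each is resilient), and for protocols in which both parties terminate under every attack (otherwise a never-terminating protocol is vacuously resilient). *)

theory Defs
  imports Complex_Main
begin

datatype party = Alice | Bob

text \<open>
  Rounds are numbered from 0. Both \<open>send\<close> and \<open>halt\<close> get the party, its input, the number \<open>t\<close>
  of rounds completed so far, and the symbols the party has received in these rounds. The
  symbols it has sent itself are a function of this information and need not be supplied.
  The party speaks the symbol \<open>send\<close> in round \<open>t\<close> if it is the speaker of that round;
  it terminates after \<open>t\<close> completed rounds, with output \<open>out\<close>, if \<open>halt\<close> yields \<open>Some out\<close>.
  On the channel, \<open>None\<close> is the special symbol sent on behalf of a terminated party.
\<close>

record 'a protocol =
  speaker :: "nat \<Rightarrow> party"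
  send :: "party \<Rightarrow> bool list \<Rightarrow> nat \<Rightarrow> 'a option list \<Rightarrow> 'a"
  halt :: "party \<Rightarrow> bool list \<Rightarrow> nat \<Rightarrow> 'a option list \<Rightarrow> (bool list \<times> bool list) option"

definition inputs :: "nat \<Rightarrow> bool list set" where
  "inputs n = {z. length z = n}"

text \<open>
  An attack is given by the sequence \<open>r\<close> of symbols delivered in each round. As the
  protocol is deterministic, every (possibly adaptive) adversary amounts to such a sequence on
  a given pair of inputs, and the rounds it corrupts are those in which \<open>r\<close> differs from the
  symbol sent.
\<close>

definition received :: "'a protocol \<Rightarrow> party \<Rightarrow> (nat \<Rightarrow> 'a option) \<Rightarrow> nat \<Rightarrow> 'a option list" where
  "received P p r t = map r (filter (\<lambda>i. speaker P i \<noteq> p) [0..<t])"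

definition halt_view ::
    "'a protocol \<Rightarrow> party \<Rightarrow> bool list \<Rightarrow> (nat \<Rightarrow> 'a option) \<Rightarrow> nat \<Rightarrow> (bool list \<times> bool list) option"
  where "halt_view P p z r t = halt P p z t (received P p r t)"

text \<open>
  Termination is irreversible, so only the first value of \<open>halt\<close> other than \<open>None\<close> counts.
  A party that terminates at round \<open>T\<close> takes part in exactly the \<open>T\<close> rounds \<open>0, \<dots>, T - 1\<close>.
\<close>

definition terminates_at ::
    "'a protocol \<Rightarrow> party \<Rightarrow> bool list \<Rightarrow> (nat \<Rightarrow> 'a option) \<Rightarrow> nat \<Rightarrow> bool" where
  "terminates_at P p z r T \<longleftrightarrow>
     halt_view P p z r T \<noteq> None \<and> (\<forall>t<T. halt_view P p z r t = None)"

fun input_of :: "bool list \<Rightarrow> bool list \<Rightarrow> party \<Rightarrow> bool list" where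
  "input_of x y Alice = x"
| "input_of x y Bob = y"

definition transmitted ::
    "'a protocol \<Rightarrow> bool list \<Rightarrow> bool list \<Rightarrow> (nat \<Rightarrow> 'a option) \<Rightarrow> nat \<Rightarrow> 'a option" where
  "transmitted P x y r i =
     (let p = speaker P i; z = input_of x y p in
      if \<exists>T\<le>i. terminates_at P p z r T then None
      else Some (send P p z i (received P p r i)))"

definition corrupted_rounds ::
    "'a protocol \<Rightarrow> bool list \<Rightarrow> bool list \<Rightarrow> (nat \<Rightarrow> 'a option) \<Rightarrow> nat \<Rightarrow> nat set" where
  "corrupted_rounds P x y r R = {i. i < R \<and> r i \<noteq> transmitted P x y r i}"

text \<open>
  Resilience only speaks about attacks under which both parties terminate. Hence a protocol has
  to guarantee termination under every attack; otherwise a protocol that never terminates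
  would be resilient to any fraction of errors.
\<close>

definition always_terminates :: "nat \<Rightarrow> 'a protocol \<Rightarrow> bool" where
  "always_terminates n P \<longleftrightarrow> (\<forall>p. \<forall>z\<in>inputs n. \<forall>r. \<exists>T. terminates_at P p z r T)"

definition resilient :: "nat \<Rightarrow> 'a protocol \<Rightarrow> real \<Rightarrow> bool" where
  "resilient n P \<alpha> \<longleftrightarrow>
     (\<forall>x\<in>inputs n. \<forall>y\<in>inputs n. \<forall>r TA TB R.
        terminates_at P Alice x r TA \<longrightarrow> terminates_at P Bob y r TB \<longrightarrow> R = max TA TB \<longrightarrow>
        real (card (corrupted_rounds P x y r R)) \<le> \<alpha> * real R \<longrightarrow>
        halt_view P Alice x r TA = Some (x, y) \<and> halt_view P Bob y r TB = Some (x, y))"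

end

theory Submission imports Defs "HOL-Library.FuncSet" begin

text \<open>
  Write \<open>a(t)\<close> and \<open>b(t)\<close> for the numbers of slots of Alice and Bob among the first \<open>t\<close> rounds and
  \<open>\<alpha> = 0.358\<close>. A party that ends up with two candidates for the other input, both at the cost of at
  most an \<open>\<alpha>\<close> fraction of the rounds, must err on one of them.

  First, Bob cannot terminate early: if he terminates at round \<open>d\<close>, then
  \<open>\<alpha> d \<ge> b(s) - \<alpha> s\<close> for all large \<open>s \<le> d\<close>. For all but one of her inputs, Alice must
  terminate by round \<open>a(d)/\<alpha>\<close>, since Bob rejects the input after hearing \<open>a(d)\<close> symbols. From round \<open>s\<close> on the adversary lets Bob hear two codewords of Alice
  alternately. Depending on whether Alice keeps hearing the Bob of the original run only up to round
  \<open>d\<close> or until she terminates, the two attacks bound the new termination time of Bob from below and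
  from above, and these bounds contradict each other.

  Second, fix two inputs of Bob under which he behaves identically for a long time, and let both
  Bobs hear the truth while Alice hears a mixture of the two, balanced as long as both Bobs are
  active. When one of them has terminated, his share of the corruptions is kept just below an
  \<open>\<alpha>\<close> fraction. The other Bob then suffers at most \<open>b(s) - \<alpha> s + O(1)\<close> corruptions for some
  round \<open>s\<close> at which he is active, which is affordable since he terminates late. Hence Alice
  can never terminate with a correct output in both cases.
\<close>

section \<open>Views, messages and slots\<close>

definition dead :: "'a protocol \<Rightarrow> party \<Rightarrow> bool list \<Rightarrow> (nat \<Rightarrow> 'a option) \<Rightarrow> nat \<Rightarrow> bool" where
  "dead P p z r i \<longleftrightarrow> (\<exists>T\<le>i. terminates_at P p z r T)"

text \<open>What the party would put on the channel in round \<open>i\<close>, whoever speaks then.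
  It depends only on what this one party hears, so the two parties can be simulated on different
  sequences.\<close>

definition msg :: "'a protocol \<Rightarrow> party \<Rightarrow> bool list \<Rightarrow> (nat \<Rightarrow> 'a option) \<Rightarrow> nat \<Rightarrow> 'a option" where
  "msg P p z r i = (if dead P p z r i then None else Some (send P p z i (received P p r i)))"

definition slots :: "'a protocol \<Rightarrow> party \<Rightarrow> nat \<Rightarrow> nat" where
  "slots P p t = card {i. i < t \<and> speaker P i = p}"

lemma transmitted_eq_msg:
  "transmitted P x y r i = msg P (speaker P i) (input_of x y (speaker P i)) r i"
  by (simp add: transmitted_def msg_def dead_def Let_def)

lemma received_cong:
  assumes "\<And>i. i < t \<Longrightarrow> speaker P i \<noteq> p \<Longrightarrow> r i = r' i"
  shows "received P p r t = received P p r' t"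
  using assms by (auto simp: received_def)

lemma halt_view_cong:
  assumes "\<And>i. i < t \<Longrightarrow> speaker P i \<noteq> p \<Longrightarrow> r i = r' i"
  shows "halt_view P p z r t = halt_view P p z r' t"
  unfolding halt_view_def using received_cong[of t P p r r'] assms by simp

lemma terminates_at_cong:
  assumes "\<And>i. i < T \<Longrightarrow> speaker P i \<noteq> p \<Longrightarrow> r i = r' i"
  shows "terminates_at P p z r T \<longleftrightarrow> terminates_at P p z r' T"
proof -
  have "halt_view P p z r t = halt_view P p z r' t" if "t \<le> T" for t
    using that assms by (intro halt_view_cong) auto
  then show ?thesis by (auto simp: terminates_at_def)
qed

lemma terminates_at_unique:
  "terminates_at P p z r T \<Longrightarrow> terminates_at P p z r T' \<Longrightarrow> T = T'"
  by (meson linorder_neqE_nat terminates_at_def)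

lemma dead_iff: "terminates_at P p z r T \<Longrightarrow> dead P p z r i \<longleftrightarrow> T \<le> i"
  unfolding dead_def using terminates_at_unique by blast

lemma msg_dead: "terminates_at P p z r T \<Longrightarrow> T \<le> i \<Longrightarrow> msg P p z r i = None"
  by (simp add: msg_def dead_iff)

lemma dead_cong:
  assumes "\<And>j. j < i \<Longrightarrow> speaker P j \<noteq> p \<Longrightarrow> r j = r' j"
  shows "dead P p z r i \<longleftrightarrow> dead P p z r' i"
  unfolding dead_def using assms by (intro ex_cong conj_cong terminates_at_cong refl) auto

lemma msg_cong:
  assumes "\<And>j. j < i \<Longrightarrow> speaker P j \<noteq> p \<Longrightarrow> r j = r' j"
  shows "msg P p z r i = msg P p z r' i"
  unfolding msg_def using dead_cong[OF assms] received_cong[OF assms] by simp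

text \<open>A terminated party no longer listens, so only the rounds before its termination matter.\<close>

lemma msg_cong_terminated:
  assumes "terminates_at P p z r T"
    and "\<And>j. j < T \<Longrightarrow> speaker P j \<noteq> p \<Longrightarrow> r j = r' j"
  shows "msg P p z r i = msg P p z r' i"
proof (cases "T \<le> i")
  case True
  moreover have "terminates_at P p z r' T" using assms terminates_at_cong by blast
  ultimately show ?thesis using assms(1) by (simp add: msg_dead)
next
  case False
  then show ?thesis using assms(2) by (intro msg_cong) auto
qed

section \<open>Counting slots\<close>

lemma slots_0 [simp]: "slots P p 0 = 0"
  by (simp add: slots_def)

lemma card_Suc_if:
  "card {i. i < Suc n \<and> Q i} = card {i. i < n \<and> Q i} + (if Q n then 1 else 0)"
proof -
  have "{i. i < Suc n \<and> Q i} = (if Q n then insert n {i. i < n \<and> Q i} else {i. i < n \<and> Q i})"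
    by (auto simp: less_Suc_eq)
  then show ?thesis by simp
qed

lemma slots_Suc: "slots P p (Suc n) = slots P p n + (if speaker P n = p then 1 else 0)"
  unfolding slots_def by (rule card_Suc_if)

lemma slots_mono: "m \<le> n \<Longrightarrow> slots P p m \<le> slots P p n"
  unfolding slots_def by (intro card_mono) auto

lemma slots_sum: "slots P Alice t + slots P Bob t = t"
proof (induction t)
  case (Suc t)
  then show ?case by (cases "speaker P t") (simp_all add: slots_Suc)
qed simp

lemma card_slots_between:
  assumes "m \<le> n"
  shows "card {i. m \<le> i \<and> i < n \<and> speaker P i = p} = slots P p n - slots P p m"
proof -
  have "{i. m \<le> i \<and> i < n \<and> speaker P i = p} =
        {i. i < n \<and> speaker P i = p} - {i. i < m \<and> speaker P i = p}"
    using assms by auto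
  moreover have "{i. i < m \<and> speaker P i = p} \<subseteq> {i. i < n \<and> speaker P i = p}"
    using assms by auto
  ultimately show ?thesis by (simp add: slots_def card_Diff_subset)
qed

text \<open>The parity of the slot counter flips at each slot of \<open>p\<close>, so a fixed parity
  takes every other slot.\<close>

lemma card_alternate_slots:
  assumes "s \<le> m"
  shows "2 * card {i. i < m \<and> s \<le> i \<and> speaker P i = p \<and> even (slots P p i) = c}
    \<le> slots P p m - slots P p s + 1"
proof -
  \<comment> \<open>The surplus 1 is granted only when the next slot of \<open>p\<close> is not a
    counted one; this makes the bound inductive.\<close>
  have "2 * card {i. i < m \<and> s \<le> i \<and> speaker P i = p \<and> even (slots P p i) = c} + slots P p s
     \<le> slots P p m + (if even (slots P p m) = c then 0 else 1)"
    using assms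
  proof (induction m rule: dec_induct)
    case base
    have "{i. i < s \<and> s \<le> i \<and> speaker P i = p \<and> even (slots P p i) = c} = {}" by auto
    then show ?case by (metis card.empty le_add1 mult_0_right add_0)
  next
    case (step m)
    then show ?case
      by (subst card_Suc_if) (auto simp: slots_Suc split: if_splits)
  qed
  then show ?thesis by (auto split: if_splits)
qed

text \<open>Turns an adaptive strategy, whose symbol in round \<open>i\<close> depends on earlier
  rounds only, into one fixed sequence by well-founded recursion.\<close>

lemma adaptive_sequence:
  fixes \<Phi> :: "(nat \<Rightarrow> 'b) \<Rightarrow> nat \<Rightarrow> 'b"
  assumes "\<And>f g i. (\<And>k. k < i \<Longrightarrow> f k = g k) \<Longrightarrow> \<Phi> f i = \<Phi> g i"
  shows "\<exists>f. \<forall>i. f i = \<Phi> f i"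
proof -
  have "\<exists>f. \<forall>i. (\<lambda>f i r. r = \<Phi> f i) f i (f i)"
  proof (rule dependent_wf_choice[OF wf_less])
    fix f g :: "nat \<Rightarrow> 'b" and i r
    assume "\<And>k. (k, i) \<in> {(x, y). x < y} \<Longrightarrow> f k = g k"
    then show "(r = \<Phi> f i) = (r = \<Phi> g i)" using assms[of i f g] by simp
  qed blast
  then show ?thesis by simp
qed

section \<open>Bounds on the termination time of Bob\<close>

locale resilient_protocol =
  fixes n :: nat and P :: "'a protocol"
  assumes always: "always_terminates n P" and resilient: "resilient n P 0.358"
begin

lemma terminates:
  assumes "z \<in> inputs n" obtains T where "terminates_at P p z r T"
proof -
  have "\<exists>T. terminates_at P p z r T" using always assms by (simp add: always_terminates_def)
  then show ?thesis using that by blast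
qed

text \<open>Gluing what Alice hears and what Bob hears into one attack costs only rounds in which an
  active listener is deceived. A wrong output must cost more than resilience tolerates.\<close>

lemma split_run:
  assumes x: "x \<in> inputs n" and y: "y \<in> inputs n"
    and T: "terminates_at P Alice x u S" "terminates_at P Bob y q D"
    and wrong: "halt_view P Alice x u S \<noteq> Some (x, y) \<or> halt_view P Bob y q D \<noteq> Some (x, y)"
  shows "179/500 * real (max S D) <
    real (card {i. i < D \<and> speaker P i = Alice \<and> q i \<noteq> msg P Alice x u i}) +
    real (card {i. i < S \<and> speaker P i = Bob \<and> u i \<noteq> msg P Bob y q i})"
    (is "_ < real (card ?A) + real (card ?B)")
proof -
  \<comment> \<open>Once the listener has terminated, the true symbol is delivered, so later rounds
    are free.\<close>
  define r where "r i = (if speaker P i = Alice then if i < D then q i else msg P Alice x u i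
    else if i < S then u i else msg P Bob y q i)" for i
  have rA: "u i = r i" if "i < S" "speaker P i \<noteq> Alice" for i
    using that by (simp add: r_def)
  have rB: "q i = r i" if "i < D" "speaker P i \<noteq> Bob" for i
    using that by (cases "speaker P i") (auto simp: r_def)
  have TA: "terminates_at P Alice x r S"
    using T(1) terminates_at_cong[OF rA] by simp
  have TB: "terminates_at P Bob y r D"
    using T(2) terminates_at_cong[OF rB] by simp
  have "halt_view P Alice x r S = halt_view P Alice x u S"
    "halt_view P Bob y r D = halt_view P Bob y q D"
    using halt_view_cong[OF rA] halt_view_cong[OF rB] by simp_all
  moreover have "halt_view P Alice x r S = Some (x, y) \<and> halt_view P Bob y r D = Some (x, y)"
    if "real (card (corrupted_rounds P x y r (max S D))) \<le> 0.358 * real (max S D)"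
    using resilient[unfolded resilient_def, rule_format, OF x y TA TB refl that] .
  ultimately have "\<not> real (card (corrupted_rounds P x y r (max S D))) \<le> 0.358 * real (max S D)"
    using wrong by metis
  moreover have "card (corrupted_rounds P x y r (max S D)) \<le> card ?A + card ?B"
  proof -
    have "corrupted_rounds P x y r (max S D) \<subseteq> ?A \<union> ?B"
    proof
      fix i assume "i \<in> corrupted_rounds P x y r (max S D)"
      then have ne: "r i \<noteq> msg P (speaker P i) (input_of x y (speaker P i)) r i"
        by (simp add: corrupted_rounds_def transmitted_eq_msg)
      have mA: "msg P Alice x r i = msg P Alice x u i"
        using msg_cong_terminated[OF T(1) rA] by simp
      have mB: "msg P Bob y r i = msg P Bob y q i"
        using msg_cong_terminated[OF T(2) rB] by simp
      show "i \<in> ?A \<union> ?B"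
        using ne mA mB by (cases "speaker P i") (auto simp: r_def split: if_splits)
    qed
    then have "card (corrupted_rounds P x y r (max S D)) \<le> card (?A \<union> ?B)"
      by (intro card_mono) auto
    also have "\<dots> \<le> card ?A + card ?B" by (rule card_Un_le)
    finally show ?thesis .
  qed
  ultimately show ?thesis by simp
qed

text \<open>Alice hears exactly what Bob says, so only her slots before \<open>d\<close> can be
  corrupted.\<close>

lemma output_bound:
  assumes x: "x \<in> inputs n" and y: "y \<in> inputs n"
    and d: "terminates_at P Bob y q d" and out: "halt_view P Bob y q d = Some (xo, yo)" "x \<noteq> xo"
    and z: "terminates_at P Alice x (msg P Bob y q) z"
  shows "179/500 * real (max z d) < real (slots P Alice d)"
proof -
  have "179/500 * real (max z d) <
    real (card {i. i < d \<and> speaker P i = Alice \<and> q i \<noteq> msg P Alice x (msg P Bob y q) i})"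
    using split_run[OF x y z d] out by simp
  moreover have "card {i. i < d \<and> speaker P i = Alice \<and> q i \<noteq> msg P Alice x (msg P Bob y q) i}
    \<le> slots P Alice d"
    unfolding slots_def by (intro card_mono) auto
  ultimately show ?thesis by linarith
qed

text \<open>Two candidates besides \<open>xo\<close> are wanted because any other output of Bob
  still misses one of them.\<close>

lemma two_other_inputs:
  assumes "n \<ge> 2"
  obtains x3 x4 where "x3 \<in> inputs n" "x4 \<in> inputs n" "x3 \<noteq> x4" "x3 \<noteq> xo" "x4 \<noteq> xo"
proof -
  define w where "w b c = b # c # replicate (n - 2) True" for b c :: bool
  have w: "w b c \<in> inputs n" for b c using assms by (auto simp: w_def inputs_def)
  have inj: "w b c = w b' c' \<longleftrightarrow> b = b' \<and> c = c'" for b c b' c' by (simp add: w_def)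
  show ?thesis
    using that[OF w w, of True True True False] that[OF w w, of True True False False]
      that[OF w w, of True False False False] inj by metis
qed

lemma Bob_listens:
  assumes "n \<ge> 2" "y \<in> inputs n" "terminates_at P Bob y q d"
  shows "179/500 * real d < real (slots P Alice d)"
proof -
  obtain xo yo where out: "halt_view P Bob y q d = Some (xo, yo)"
    using assms(3) by (auto simp: terminates_at_def)
  obtain x where x: "x \<in> inputs n" "x \<noteq> xo" using two_other_inputs[OF assms(1)] by metis
  obtain z where "terminates_at P Alice x (msg P Bob y q) z" using terminates[OF x(1)] .
  then show ?thesis using output_bound[OF x(1) assms(2,3) out x(2)] by fastforce
qed

section \<open>Bob does not terminate early\<close>

lemma Bob_late_arith_before:
  fixes s d D a0 b0 aD bD :: real
  assumes "100 \<le> s" "0 \<le> a0" "a0 + b0 = s" "179/500 * d < b0 - 179/500 * s + 2" "s \<le> d" "D \<le> d"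
    "aD + bD = D" "179/500 * D < aD" "179/500 * D < a0 + (aD - a0 + 1) / 2 + (aD - aD) + (bD - b0)"
  shows False
  \<comment> \<open>Eliminating \<open>aD\<close>, \<open>bD\<close> and \<open>D\<close> leaves
    \<open>b0\<close> below about \<open>179/1000 * s\<close>, whereas \<open>s \<le> d\<close>
    forces it above about \<open>716/1000 * s\<close>; \<open>100 \<le> s\<close> absorbs the
    additive constants.\<close>
  using assms by (simp add: field_simps; linarith)

text \<open>Of the last two hypotheses, the first bounds \<open>D\<close> from below because
  \<open>aD \<le> D - bM\<close>, the second from above. With \<open>179/500 * M < a\<close> and the
  bound on \<open>d\<close> they clash once \<open>s\<close> outgrows the additive
  constants.\<close>

lemma Bob_late_arith_after:
  fixes s d M D a0 b0 a b aM bM aD bD :: real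
  assumes "100 \<le> s" "0 \<le> a0" "a0 + b0 = s" "179/500 * d < b0 - 179/500 * s + 2" "s \<le> d"
    "a + b = d" "aM + bM = M" "aD + bD = D" "179/500 * d < a" "179/500 * M < a"
    "a0 \<le> a" "b0 \<le> b" "a \<le> aM" "b \<le> bM" "aM \<le> aD" "bM \<le> bD"
    "179/500 * D < a0 + (a - a0 + 1) / 2 + (aD - a) + (b - b0)"
    "179/500 * D < a0 + (aM - a0 + 1) / 2 + (bM - b0)"
  shows False
  using assms by (simp add: field_simps; linarith)

text \<open>In the attack on Alice, the left side bounds what the Bob who stays active is charged
  when the other has absorbed nearly \<open>179/500 * s\<close>; the 2 covers rounding.\<close>

lemma Bob_late:
  assumes n: "n \<ge> 2" and y: "y \<in> inputs n" and d: "terminates_at P Bob y q0 d"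
    and s: "100 \<le> s" "s \<le> d"
  shows "real (slots P Bob s) - 179/500 * real s + 2 \<le> 179/500 * real d"
proof (rule ccontr)
  assume early: "\<not> ?thesis"
  define u0 where "u0 = msg P Bob y q0"
  obtain xo yo where out: "halt_view P Bob y q0 d = Some (xo, yo)"
    using d by (auto simp: terminates_at_def)
  obtain x3 x4 where x34: "x3 \<in> inputs n" "x4 \<in> inputs n" "x3 \<noteq> x4" "x3 \<noteq> xo" "x4 \<noteq> xo"
    using two_other_inputs[OF n] .
  obtain z3 where z3: "terminates_at P Alice x3 u0 z3" using terminates[OF x34(1)] .
  obtain z4 where z4: "terminates_at P Alice x4 u0 z4" using terminates[OF x34(2)] .
  define Z where "Z = max z3 z4"
  define A where "A t = real (slots P Alice t)" for t
  define B where "B t = real (slots P Bob t)" for t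
  have AB: "A t + B t = real t" for t
    unfolding A_def B_def using slots_sum[of P t] by (metis of_nat_add)
  have mono: "A t \<le> A t'" "B t \<le> B t'" if "t \<le> t'" for t t'
    using slots_mono[OF that] by (auto simp: A_def B_def)
  \<comment> \<open>The output \<open>xo\<close> is wrong for both candidates at a cost of at most
    \<open>A d\<close>; a longer run of either Alice would make this cost tolerable.\<close>
  have ZA: "179/500 * real Z < A d" and dA: "179/500 * real d < A d"
    using output_bound[OF x34(1) y d out x34(4) z3[unfolded u0_def]]
      output_bound[OF x34(2) y d out x34(5) z4[unfolded u0_def]]
    by (auto simp: Z_def A_def max_def split: if_splits)
  \<comment> \<open>Before round \<open>s\<close> Bob cannot tell this from \<open>q0\<close>;
    afterwards each candidate supplies every other symbol.\<close>
  define q where "q i = (if i < s then q0 i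
    else msg P Alice (if even (slots P Alice i) then x3 else x4) u0 i)" for i
  obtain D where D: "terminates_at P Bob y q D" using terminates[OF y] .
  have sD: "s \<le> D"
  proof (rule ccontr)
    assume "\<not> s \<le> D"
    then have "terminates_at P Bob y q0 D" using D terminates_at_cong[of D P Bob q q0]
      by (auto simp: q_def)
    with d have "D = d" by (simp add: terminates_at_unique)
    with \<open>\<not> s \<le> D\<close> s show False by simp
  qed
  have DA: "179/500 * real D < A D"
    using Bob_listens[OF n y D] by (simp add: A_def)
  have u0_prefix: "u0 i = msg P Bob y q i" if "i \<le> s" for i
    unfolding u0_def using that by (intro msg_cong) (auto simp: q_def)

  text \<open>Bob hears the two codewords alternately, while Alice, with either of the two inputs, hears
    the messages of the unperturbed Bob up to round \<open>e\<close>, and the true messages from then on.\<close>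
  have hybrid: "\<exists>x\<in>{x3, x4}. 179/500 * real D < A s + (A (min D e) - A s + 1) / 2 +
      real (card {i. e \<le> i \<and> i < D \<and> speaker P i = Alice \<and>
        q i \<noteq> msg P Alice x (\<lambda>i. if i < e then u0 i else msg P Bob y q i) i}) +
      real (card {i. s \<le> i \<and> i < e \<and> speaker P i = Bob \<and> u0 i \<noteq> msg P Bob y q i})"
    if e: "s \<le> e" for e
  proof -
    define u where "u i = (if i < e then u0 i else msg P Bob y q i)" for i
    obtain xo' yo' where out': "halt_view P Bob y q D = Some (xo', yo')"
      using D by (auto simp: terminates_at_def)
    \<comment> \<open>The candidate \<open>x\<close> is one that Bob's new output misses; from
      \<open>s\<close> on, the slots of parity class \<open>c\<close> carry the other candidate's
      symbols.\<close>
    obtain c where c: "(if c then x4 else x3) \<noteq> xo'" using x34(3) by metis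
    define x where "x = (if c then x4 else x3)"
    have x: "x \<in> inputs n" using x34 by (simp add: x_def)
    obtain z where z: "terminates_at P Alice x u z" using terminates[OF x] .
    let ?A1 = "{i. i < s \<and> speaker P i = Alice}"
    let ?A2 = "{i. i < min D e \<and> s \<le> i \<and> speaker P i = Alice \<and> even (slots P Alice i) = c}"
    let ?A3 = "{i. e \<le> i \<and> i < D \<and> speaker P i = Alice \<and> q i \<noteq> msg P Alice x u i}"
    let ?B = "{i. s \<le> i \<and> i < e \<and> speaker P i = Bob \<and> u0 i \<noteq> msg P Bob y q i}"
    have "{i. i < D \<and> speaker P i = Alice \<and> q i \<noteq> msg P Alice x u i} \<subseteq> ?A1 \<union> ?A2 \<union> ?A3"
    proof
      fix i assume i: "i \<in> {i. i < D \<and> speaker P i = Alice \<and> q i \<noteq> msg P Alice x u i}"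
      have "msg P Alice x u i = msg P Alice x u0 i" if "i < e"
        using that by (intro msg_cong) (auto simp: u_def)
      then show "i \<in> ?A1 \<union> ?A2 \<union> ?A3"
        using i by (cases "i < e") (auto simp: q_def x_def split: if_splits)
    qed
    then have "card {i. i < D \<and> speaker P i = Alice \<and> q i \<noteq> msg P Alice x u i}
        \<le> card (?A1 \<union> ?A2 \<union> ?A3)"
      by (intro card_mono) auto
    also have "\<dots> \<le> card ?A1 + card ?A2 + card ?A3"
      by (meson add_le_mono1 card_Un_le le_trans)
    finally have 1: "real (card {i. i < D \<and> speaker P i = Alice \<and> q i \<noteq> msg P Alice x u i})
      \<le> A s + real (card ?A2) + real (card ?A3)"
      by (simp add: A_def slots_def)
    have "2 * card ?A2 \<le> slots P Alice (min D e) - slots P Alice s + 1"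
      using e sD by (intro card_alternate_slots) auto
    then have 2: "real (card ?A2) \<le> (A (min D e) - A s + 1) / 2"
      using slots_mono[of s "min D e" P Alice] e sD by (simp add: A_def field_simps)
    have "{i. i < z \<and> speaker P i = Bob \<and> u i \<noteq> msg P Bob y q i} \<subseteq> ?B"
      using u0_prefix by (auto simp: u_def intro: ccontr split: if_splits)
    then have 3: "card {i. i < z \<and> speaker P i = Bob \<and> u i \<noteq> msg P Bob y q i} \<le> card ?B"
      by (intro card_mono) auto
    have "179/500 * real (max z D) <
      real (card {i. i < D \<and> speaker P i = Alice \<and> q i \<noteq> msg P Alice x u i}) +
      real (card {i. i < z \<and> speaker P i = Bob \<and> u i \<noteq> msg P Bob y q i})"
      using split_run[OF x y z D] out' c by (simp add: x_def)
    with 1 2 3 have "179/500 * real D < A s + (A (min D e) - A s + 1) / 2 +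
      real (card ?A3) + real (card ?B)" by linarith
    then show ?thesis unfolding u_def x_def by (cases c) auto
  qed
  \<comment> \<open>From round \<open>max d D\<close> on, Bob has terminated in both runs, so both
    sequences carry \<open>None\<close>.\<close>
  have cardB: "real (card {i. s \<le> i \<and> i < e \<and> speaker P i = Bob \<and> u0 i \<noteq> msg P Bob y q i})
      \<le> B (min e (max d D)) - B s" if "s \<le> e" for e
  proof -
    have "{i. s \<le> i \<and> i < e \<and> speaker P i = Bob \<and> u0 i \<noteq> msg P Bob y q i}
        \<subseteq> {i. s \<le> i \<and> i < min e (max d D) \<and> speaker P i = Bob}"
    proof
      fix i assume i: "i \<in> {i. s \<le> i \<and> i < e \<and> speaker P i = Bob \<and> u0 i \<noteq> msg P Bob y q i}"
      then have "\<not> max d D \<le> i"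
        using msg_dead[OF d, of i] msg_dead[OF D, of i] by (auto simp: u0_def)
      with i show "i \<in> {i. s \<le> i \<and> i < min e (max d D) \<and> speaker P i = Bob}" by auto
    qed
    then have "card {i. s \<le> i \<and> i < e \<and> speaker P i = Bob \<and> u0 i \<noteq> msg P Bob y q i}
        \<le> slots P Bob (min e (max d D)) - slots P Bob s"
      using that sD by (subst card_slots_between[symmetric]) (auto intro: card_mono)
    moreover have "s \<le> min e (max d D)" using that sD by auto
    ultimately show ?thesis
      using slots_mono[of s "min e (max d D)" P Bob] unfolding B_def by linarith
  qed
  have cardA: "real (card {i. e \<le> i \<and> i < D \<and> speaker P i = Alice \<and> Q i}) \<le> A D - A e"
    if "e \<le> D" for e Q
  proof -
    have "card {i. e \<le> i \<and> i < D \<and> speaker P i = Alice \<and> Q i} \<le> slots P Alice D - slots P Alice e"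
      using that by (subst card_slots_between[symmetric]) (auto intro: card_mono)
    then show ?thesis using slots_mono[OF that, of P Alice] unfolding A_def by linarith
  qed
  \<comment> \<open>First attack: Alice hears the original Bob up to \<open>min d D\<close>, and all
    her later slots are counted as corrupted.\<close>
  have T: "179/500 * real D < A s + (A (min d D) - A s + 1) / 2 + (A D - A (min d D))
      + (B (min d D) - B s)"
  proof -
    let ?e = "min d D"
    have m: "s \<le> ?e" "?e \<le> D" "min D ?e = ?e" "min ?e (max d D) = ?e" using s sD by auto
    obtain x where "179/500 * real D < A s + (A (min D ?e) - A s + 1) / 2 +
      real (card {i. ?e \<le> i \<and> i < D \<and> speaker P i = Alice \<and>
        q i \<noteq> msg P Alice x (\<lambda>i. if i < ?e then u0 i else msg P Bob y q i) i}) +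
      real (card {i. s \<le> i \<and> i < ?e \<and> speaker P i = Bob \<and> u0 i \<noteq> msg P Bob y q i})"
      using hybrid[OF m(1)] by blast
    then show ?thesis
      using cardA[OF m(2), of "\<lambda>i. q i \<noteq> msg P Alice x (\<lambda>i. if i < ?e then u0 i else msg P Bob y q i) i"]
        cardB[OF m(1)] unfolding m by linarith
  qed
  have early': "179/500 * real d < B s - 179/500 * real s + 2"
    using early by (simp add: B_def)
  have pos: "0 \<le> A s" by (simp add: A_def)
  show False
  proof (cases "D \<le> d")
    case True
    then have "real D \<le> real d" "real s \<le> real d" "100 \<le> real s" and m: "min d D = D"
      using s by auto
    then show False
      using Bob_late_arith_before[OF _ pos AB early' _ _ AB DA T[unfolded m]] by blast
  next
    case False
    \<comment> \<open>Second attack: by round \<open>e\<close> Alice has terminated with either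
      candidate, having heard only \<open>u0\<close>. From then on the delivered and the true symbol
      are both \<open>None\<close>, so her slots cost nothing.\<close>
    define e where "e = max Z d"
    define M where "M = min D e"
    let ?u = "\<lambda>i. if i < e then u0 i else msg P Bob y q i"
    have silent: "q i = msg P Alice x ?u i" if i: "e \<le> i" and x: "x \<in> {x3, x4}" for i x
    proof -
      obtain z where z: "terminates_at P Alice x u0 z" "z \<le> e"
        using x z3 z4 by (auto simp: e_def Z_def)
      have "msg P Alice x ?u i = msg P Alice x u0 i"
        using z(2) by (intro msg_cong_terminated[OF z(1), symmetric]) auto
      also have "\<dots> = None" using z i by (auto intro: msg_dead)
      also have "None = q i"
        using i s msg_dead[OF z3] msg_dead[OF z4] by (auto simp: q_def e_def Z_def)
      finally show ?thesis by simp
    qed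
    have empty: "{i. e \<le> i \<and> i < D \<and> speaker P i = Alice \<and> q i \<noteq> msg P Alice x ?u i} = {}"
      if x: "x \<in> {x3, x4}" for x using silent[OF _ x] by auto
    have m: "s \<le> e" "min e (max d D) = M" using s False by (auto simp: M_def e_def)
    obtain x where x: "x \<in> {x3, x4}" and "179/500 * real D < A s + (A (min D e) - A s + 1) / 2 +
      real (card {i. e \<le> i \<and> i < D \<and> speaker P i = Alice \<and>
        q i \<noteq> msg P Alice x ?u i}) +
      real (card {i. s \<le> i \<and> i < e \<and> speaker P i = Bob \<and> u0 i \<noteq> msg P Bob y q i})"
      using hybrid[OF m(1)] by blast
    then have F: "179/500 * real D < A s + (A M - A s + 1) / 2 + (B M - B s)"
      using cardB[OF m(1)] unfolding empty[OF x] m M_def[symmetric] by simp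
    have "179/500 * real M < A d"
      using ZA dA by (auto simp: M_def e_def min_def max_def)
    moreover have "d \<le> M" "M \<le> D" "real s \<le> real d" "100 \<le> real s" and m: "min d D = d"
      using False s by (auto simp: M_def e_def)
    moreover have "A s \<le> A d" "B s \<le> B d" "A d \<le> A M" "B d \<le> B M" "A M \<le> A D" "B M \<le> B D"
      using mono s(2) \<open>d \<le> M\<close> \<open>M \<le> D\<close> by blast+
    ultimately show False
      using Bob_late_arith_after[OF _ pos AB early' _ AB AB AB dA _ _ _ _ _ _ _ T[unfolded m] F]
      by blast
  qed
qed

end

section \<open>Confusing Alice\<close>

text \<open>All words of length up to \<open>t\<close> are compared, reachable or not, which frees
  the condition from the speaker order. Of \<open>halt\<close> only the fact of halting is compared,
  as the outputs may differ.\<close>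

definition same_until :: "'a protocol \<Rightarrow> nat \<Rightarrow> bool list \<Rightarrow> bool list \<Rightarrow> bool" where
  "same_until P t0 y y' \<longleftrightarrow> (\<forall>t<t0. \<forall>w. length w \<le> t \<longrightarrow>
     send P Bob y t w = send P Bob y' t w \<and> (halt P Bob y t w = None \<longleftrightarrow> halt P Bob y' t w = None))"

text \<open>Bob's behaviour in the first \<open>t0\<close> rounds is one of \<open>card F\<close>
  tables, a number independent of \<open>n\<close> and \<open>P\<close>; among \<open>2 ^ n\<close>
  inputs two share a table.\<close>

lemma same_until_inputs:
  "\<exists>N. \<forall>n\<ge>N. \<forall>P :: ('a :: finite) protocol. \<exists>y\<in>inputs n. \<exists>y'\<in>inputs n. y \<noteq> y' \<and> same_until P t0 y y'"
proof -
  define W :: "(nat \<times> 'a option list) set" where "W = (SIGMA t:{..<t0}. {w. length w \<le> t})"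
  have "finite {w :: 'a option list. length w \<le> t}" for t
    using finite_lists_length_le[of "UNIV :: 'a option set" t] by simp
  then have "finite W" unfolding W_def by (intro finite_SigmaI) auto
  define F where "F = (W \<rightarrow>\<^sub>E (UNIV :: ('a \<times> bool) set))"
  have F: "finite F" unfolding F_def using \<open>finite W\<close> by (intro finite_PiE) auto
  have "\<exists>y\<in>inputs n. \<exists>y'\<in>inputs n. y \<noteq> y' \<and> same_until P t0 y y'" if n: "card F \<le> n" for n and P :: "'a protocol"
  proof -
    define beh where "beh y = restrict (\<lambda>(t, w). (send P Bob y t w, halt P Bob y t w = None)) W" for y
    have "beh ` inputs n \<subseteq> F" by (auto simp: beh_def F_def)
    then have "card (beh ` inputs n) \<le> card F" using F by (intro card_mono)
    also have "\<dots> < 2 ^ n" using n less_exp[of n] by linarith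
    also have "\<dots> = card (inputs n)"
      using card_lists_length_eq[of "UNIV :: bool set" n] by (simp add: inputs_def)
    finally have "\<not> inj_on beh (inputs n)" by (rule pigeonhole)
    then obtain y y' where y: "y \<in> inputs n" "y' \<in> inputs n" "y \<noteq> y'" "beh y = beh y'"
      by (auto simp: inj_on_def)
    have "same_until P t0 y y'"
      unfolding same_until_def
    proof (intro allI impI)
      fix t w assume "t < t0" "length (w :: 'a option list) \<le> t"
      then have "(t, w) \<in> W" by (simp add: W_def)
      then show "send P Bob y t w = send P Bob y' t w \<and>
          (halt P Bob y t w = None \<longleftrightarrow> halt P Bob y' t w = None)"
        using fun_cong[OF y(4), of "(t, w)"] by (simp add: beh_def)
    qed
    with y show ?thesis by blast
  qed
  then show ?thesis by blast
qed

lemma length_received: "length (received P p r t) \<le> t"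
  unfolding received_def using length_filter_le[of _ "[0..<t]"] by simp

lemma same_until_terminates:
  assumes "same_until P t0 y y'" "T < t0"
  shows "terminates_at P Bob y r T \<longleftrightarrow> terminates_at P Bob y' r T"
proof -
  have "halt_view P Bob y r t = None \<longleftrightarrow> halt_view P Bob y' r t = None" if "t \<le> T" for t
    using assms that length_received[of P Bob r t] unfolding same_until_def halt_view_def by simp
  then show ?thesis by (auto simp: terminates_at_def)
qed

lemma same_until_msg:
  assumes "same_until P t0 y y'" "i < t0"
  shows "msg P Bob y r i = msg P Bob y' r i"
proof -
  have "dead P Bob y r i \<longleftrightarrow> dead P Bob y' r i"
    unfolding dead_def using assms
    by (intro ex_cong conj_cong refl same_until_terminates[OF assms(1)]) auto
  then show ?thesis
    using assms length_received[of P Bob r i] by (simp add: msg_def same_until_def)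
qed

section \<open>The attack on Alice\<close>

context resilient_protocol
begin

lemma no_indistinguishable_inputs:
  assumes n: "n \<ge> 2" and ys: "\<And>c. ys c \<in> inputs n" and neq: "ys True \<noteq> ys False"
    and same: "same_until P 100 (ys True) (ys False)"
  shows False
proof -
  define x where "x = ys True"
  have x: "x \<in> inputs n" by (simp add: x_def ys)
  define heard where "heard u = msg P Alice x u" for u
  define cost where "cost u c i =
    card {k. k < i \<and> speaker P k = Bob \<and> u k \<noteq> msg P Bob (ys c) (heard u) k}" for u c i
  define alone where "alone u c i \<longleftrightarrow>
    dead P Bob (ys c) (heard u) i \<and> \<not> dead P Bob (ys (\<not> c)) (heard u) i" for u c i
  define cheap where "cheap u c i \<longleftrightarrow> real (cost u c i) + 1 \<le> 179/500 * real i" for u c i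
  \<comment> \<open>Names the Bob whose symbol is withheld. Once exactly one has terminated, he is
    charged while \<open>cheap\<close> leaves room for one more corruption; otherwise the one
    charged less so far is.\<close>
  define charged where "charged u i \<longleftrightarrow>
    (if alone u True i then cheap u True i
     else if alone u False i then \<not> cheap u False i
     else cost u True i \<le> cost u False i)" for u i
  \<comment> \<open>The rule refers to \<open>u\<close> itself, but only through earlier
    rounds.\<close>
  have "\<exists>u. \<forall>i. u i = msg P Bob (ys (\<not> charged u i)) (heard u) i"
  proof (rule adaptive_sequence)
    fix f g :: "nat \<Rightarrow> 'a option" and i
    assume fg: "\<And>k. k < i \<Longrightarrow> f k = g k"
    have h: "heard f k = heard g k" if "k \<le> i" for k
      unfolding heard_def using that fg by (intro msg_cong) auto
    have m: "msg P Bob z (heard f) k = msg P Bob z (heard g) k" if "k \<le> i" for z k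
      using that h by (intro msg_cong) auto
    have dd: "dead P Bob z (heard f) i = dead P Bob z (heard g) i" for z
      using h by (intro dead_cong) auto
    have "cost f c i = cost g c i" for c
      unfolding cost_def using fg m by (intro arg_cong[where f = card]) auto
    then have "charged f i = charged g i"
      unfolding charged_def alone_def cheap_def dd by simp
    with m show "msg P Bob (ys (\<not> charged f i)) (heard f) i = msg P Bob (ys (\<not> charged g i)) (heard g) i"
      by simp
  qed
  then obtain u where u: "\<And>i. u i = msg P Bob (ys (\<not> charged u i)) (heard u) i" by blast
  define q where "q = heard u"
  define C where "C c i = cost u c i" for c i
  define J where "J i = charged u i" for i
  have C0: "C c 0 = 0" for c by (simp add: C_def cost_def)
  have CSuc: "C c (Suc i) = C c i +
      (if speaker P i = Bob \<and> u i \<noteq> msg P Bob (ys c) q i then 1 else 0)" for c i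
    unfolding C_def cost_def q_def by (rule card_Suc_if)
  have uJ: "u i = msg P Bob (ys (\<not> J i)) q i" for i
    unfolding J_def q_def by (rule u)
  have charge_step: "C c (Suc i) \<le> C c i + (if speaker P i = Bob \<and> J i = c then 1 else 0)" for c i
    unfolding CSuc using uJ[of i] by (cases c; cases "J i") auto
  have inc: "C c i \<le> C c (Suc i)" for c i unfolding CSuc by simp
  have total: "C True i + C False i \<le> slots P Bob i" for i
  proof (induction i)
    case (Suc i)
    then show ?case using charge_step[of True i] charge_step[of False i]
      by (cases "J i") (auto simp: slots_Suc split: if_splits)
  qed (simp add: C0)
  obtain d where d: "\<And>c. terminates_at P Bob (ys c) q (d c)"
  proof -
    have "\<exists>T. terminates_at P Bob (ys c) q T" for c
      by (rule terminates[OF ys[of c]]) blast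
    then show ?thesis using that by metis
  qed
  obtain b where b: "d b \<le> d (\<not> b)" using linear[of "d True" "d False"] by (metis (full_types))
  obtain S where S: "terminates_at P Alice x u S" using terminates[OF x] .
  have dead: "dead P Bob (ys c) q i \<longleftrightarrow> d c \<le> i" for c i using dead_iff[OF d] .

  \<comment> \<open>Both Bobs are affordable, so Alice, hearing the same \<open>u\<close>, would
    have to output both inputs.\<close>
  have "real (C c S) \<le> 179/500 * real (max S (d c))" for c
  proof (cases "d b < 100")
    case True
    \<comment> \<open>The Bobs agree before round 100, so they terminate together and each delivered
      symbol is genuine for both.\<close>
    have "terminates_at P Bob (ys (\<not> b)) q (d b)"
      using same_until_terminates[OF same True, of q] d[of b] by (cases b) auto
    then have "d (\<not> b) = d b" using d[of "\<not> b"] terminates_at_unique by blast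
    then have dd: "d c = d b" for c by (cases "c = b") auto
    have "msg P Bob (ys True) q i = msg P Bob (ys False) q i" for i
    proof (cases "i < 100")
      case True
      then show ?thesis by (rule same_until_msg[OF same])
    next
      case False
      then have "d c \<le> i" for c using dd[of c] \<open>d b < 100\<close> by simp
      then show ?thesis using msg_dead[OF d] by simp
    qed
    then have "u i = msg P Bob (ys c) q i" for i using uJ[of i] by (cases c; cases "J i") simp_all
    then have "C c i = 0" for i by (induction i) (simp_all add: C0 CSuc)
    then show ?thesis by simp
  next
    case False
    then have db: "100 \<le> d b" by simp
    have Alice_slots: "real (slots P Alice t) + real (slots P Bob t) = real t" for t
      using slots_sum[of P t] by (metis of_nat_add)
    have balanced: "C c i \<le> C (\<not> c) i + 1" if "i \<le> d b" for c i
      using that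
    proof (induction i arbitrary: c)
      case (Suc i)
      have "\<not> alone u True i" "\<not> alone u False i"
        using Suc.prems b dead unfolding alone_def q_def[symmetric] by (cases b; auto)+
      then have "J i \<longleftrightarrow> C True i \<le> C False i" by (simp add: J_def charged_def C_def)
      moreover have "C c i \<le> C (\<not> c) i + 1" using Suc by simp
      ultimately show ?case using charge_step[of c i] inc[of "\<not> c" i]
        by (cases c; cases "J i") (auto split: if_splits)
    qed (simp add: C0)
    have half: "2 * real (C c i) \<le> real (slots P Bob i) + 1" if "i \<le> d b" for c i
      using balanced[OF that, of c] total[of i] by (cases c) auto
    have listens: "real (slots P Bob (d c)) < 321/500 * real (d c)" for c
      using Bob_listens[OF n ys d, of c] Alice_slots[of "d c"] by linarith
    \<comment> \<open>Each Bob carries about half of the slots, at most about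
      \<open>321/1000 * d b\<close>; \<open>100 \<le> d b\<close> covers the rounding.\<close>
    have start: "real (C c (d b)) \<le> 179/500 * real (d b)" for c
      using half[of "d b" c] listens[of b] db by simp
    have charge: "J i = b \<longleftrightarrow> real (C b i) + 1 \<le> 179/500 * real i" if "d b \<le> i" "i < d (\<not> b)" for i
    proof -
      have "alone u b i" "\<not> alone u (\<not> b) i"
        using that dead unfolding alone_def q_def[symmetric] by auto
      then show ?thesis by (cases b) (auto simp: J_def charged_def cheap_def C_def)
    qed
    have first: "real (C b i) \<le> 179/500 * real i" if "d b \<le> i" "i \<le> d (\<not> b)" for i
      using that
    proof (induction i rule: dec_induct)
      case base
      then show ?case using start[of b] by simp
    next
      case (step i)
      then show ?case using charge[of i] charge_step[of b i] by (cases "J i = b") (auto split: if_splits)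
    qed
    have second: "real (C (\<not> b) i) \<le> 179/500 * real (d (\<not> b))" if "d b \<le> i" "i \<le> d (\<not> b)" for i
      using that
    proof (induction i rule: dec_induct)
      case base
      have "real (d b) \<le> real (d (\<not> b))" using b by simp
      then show ?case using start[of "\<not> b"] by linarith
    next
      case (step i)
      show ?case
      proof (cases "J i = b")
        case True
        then have "C (\<not> b) (Suc i) \<le> C (\<not> b) i" using charge_step[of "\<not> b" i] by auto
        then show ?thesis using step by simp
      next
        case False
        \<comment> \<open>The active Bob pays only when the terminated one has nearly exhausted his
          budget, so that share of the slots is already gone.\<close>
        then have "179/500 * real i < real (C b i) + 1" using charge[of i] step by auto
        moreover have "C (\<not> b) (Suc i) \<le> C (\<not> b) i + 1"
          using charge_step[of "\<not> b" i] by (auto split: if_splits)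
        moreover have "C b i + C (\<not> b) i \<le> slots P Bob i" using total[of i] by (cases b) auto
        moreover have "real (slots P Bob i) - 179/500 * real i + 2 \<le> 179/500 * real (d (\<not> b))"
          using step db by (intro Bob_late[OF n ys d]) auto
        ultimately show ?thesis by linarith
      qed
    qed
    have frozen: "C c i = C c (d (\<not> b))" if "d (\<not> b) \<le> i" for c i
      using that
    proof (induction i rule: dec_induct)
      case (step i)
      have "d c \<le> i" for c using step(1) b by (cases "c = b") auto
      then have "msg P Bob (ys c) q i = None" for c using msg_dead[OF d] by simp
      with uJ[of i] step show ?case by (simp add: CSuc)
    qed simp
    have other: "c = b \<or> c = (\<not> b)" by auto
    consider "S \<le> d b" | "d b < S" "S \<le> d (\<not> b)" | "d (\<not> b) < S" by linarith
    then show ?thesis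
    proof cases
      case 1
      \<comment> \<open>Alice stops first, but the fraction is taken of the whole run, up to
        \<open>d c\<close>.\<close>
      then have "S \<le> d c" "100 \<le> real (d c)" using other b db by auto
      moreover have "slots P Bob S \<le> slots P Bob (d c)" using \<open>S \<le> d c\<close> by (rule slots_mono)
      ultimately show ?thesis using half[OF 1, of c] listens[of c] by (simp add: max_absorb2)
    next
      case 2
      then show ?thesis using first[of S] second[of S] other by (auto simp: max_def)
    next
      case 3
      then have "C c S = C c (d (\<not> b))" by (intro frozen) auto
      moreover have "real (C c (d (\<not> b))) \<le> 179/500 * real (d (\<not> b))"
        using first[OF b] second[OF b] other by auto
      moreover have "real (d (\<not> b)) \<le> real (max S (d c))" using 3 by auto
      ultimately show ?thesis by simp
    qed
  qed
  \<comment> \<open>By the choice of \<open>q\<close> Bob hears the truth, so only Alice is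
    deceived.\<close>
  moreover have "{i. i < d c \<and> speaker P i = Alice \<and> q i \<noteq> msg P Alice x u i} = {}" for c
    by (simp add: q_def heard_def)
  ultimately have "halt_view P Alice x u S = Some (x, ys c)" for c
    using split_run[OF x ys S d, of c] unfolding C_def cost_def q_def[symmetric]
    by (metis (no_types, lifting) add_0 card.empty not_less of_nat_0)
  then show False using neq by (metis option.inject prod.inject)
qed

end

theorem theorem1p3:
  "\<exists>N. \<forall>n\<ge>N. \<not> (\<exists>P :: ('a :: finite) protocol. always_terminates n P \<and> resilient n P 0.358)"
proof -
  obtain N where N: "\<And>n (P :: 'a protocol). n \<ge> N \<Longrightarrow>
      \<exists>y\<in>inputs n. \<exists>y'\<in>inputs n. y \<noteq> y' \<and> same_until P 100 y y'"
    using same_until_inputs[where ?'a = 'a, of 100] by blast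
  have False if n: "n \<ge> max N 2" and P: "always_terminates n P" "resilient n P 0.358" for n and P :: "'a protocol"
  proof -
    interpret resilient_protocol n P using P by unfold_locales
    obtain y y' where y: "y \<in> inputs n" "y' \<in> inputs n" "y \<noteq> y'" "same_until P 100 y y'"
      using N[of n P] n by auto
    show False
      by (rule no_indistinguishable_inputs[where ys = "\<lambda>c. if c then y else y'"]) (use n y in auto)
  qed
  then show ?thesis by blast
qed

end
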